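(* Let $u(x,t)$ be a non-negative solution of the initial boundary value problem (P) described in the context. Assume $\alpha\ge 2-\delta$ and $\alpha>n\mu_0$. Write $\theta=\theta_\alpha$, $\mu_1=\mu_{1,\alpha}$ and let $C_1,C_2,C_3>0$ be as in the context (so $C_3=C_{3,\alpha}=C_2\mu_1/\alpha$). (i) If $T>0$ satisfies $$\int_0^T \Big(1+\|\varphi^-(t)\|_{L^\infty(\Gamma)}^{\frac{2-a}{(1-a)(1-\theta)}}\Big)\,dt<\frac1{C_3}\Big(1+\int_U u_0^\alpha(x)\,dx\Big)^{-\mu_1/\alpha},$$ then for all $t\in(0,T]$ $$\int_U u^\alpha(x,t)\,dx\le\Big\{\Big(1+\int_U u_0^\alpha(x)\,dx\Big)^{-\mu_1/\alpha}-C_3\int_0^t\Big(1+\|\varphi^-(\tau)\|_{L^\infty(\Gamma)}^{\frac{2-a}{(1-a)(1-\theta)}}\Big)d\tau\Big\}^{-\alpha/\mu_1}.$$ (ii) Consequently, if $T>0$ satisfies $$\int_0^T \Big(1+\|\varphi^-(t)\|_{L^\infty(\Gamma)}^{\frac{2-a}{(1-a)(1-\theta)}}\Big)\,dt\le\frac{1-2^{-\mu_1/\alpha}}{C_3}\Big(1+\int_U u_0^\alpha(x)\,dx\Big)^{-\mu_1/\alpha},$$ then $$\int_U u^\alpha(x,t)\,dx\le 2\Big(1+\int_U u_0^\alpha(x)\,dx\Big)\quad\text{for all }t\in(0,T],$$ $$\int_0^T\int_U u^{\alpha+\delta-2}(x,t)|\nabla u(x,t)|^{2-a}\,dx\,dt\le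 C\Big(1+\int_U u_0^\alpha(x)\,dx\Big),$$ where $C>0$ depends on $\alpha$ (and on $\lambda,g,n,U$).
   Context: Setting. $n\ge2$ is an integer; $U\subset\mathbb R^n$ is open and bounded with $C^1$ boundary $\Gamma=\partial U$ and outward normal $\vec\nu$. Fix an integer $N\ge1$, reals $0=\gamma_0<\gamma_1<\dots<\gamma_N$ and $a_0,\dots,a_N>0$, and set $g(s)=\sum_{i=0}^N a_is^{\gamma_i}$ for $s\ge0$. For $\xi\ge0$, $K(\xi)=1/g(s(\xi))$, where $s(\xi)$ is the unique non-negative solution $s$ of $s\,g(s)=\xi$. Put $a=\gamma_N/(\gamma_N+1)\in(0,1)$. Fix $\lambda\in(0,1]$ and set $\delta=1-\lambda$, $\alpha_*=n(a-\delta)/(2-a)$, $\mu_0=(a-\delta)/(1-a)$. Standing assumption: $a>\delta$. Problem (P): $\partial_t(u^\lambda)=\nabla\cdot(K(|\nabla u|)\nabla u)$ in $U\times(0,\infty)$; $u(x,0)=u_0(x)$ in $U$; $K(|\nabla u|)\frac{\partial u}{\partial\vec\nu}+\varphi u^\lambda=0$ on $\Gamma\times(0,\infty)$, where $u_0(x)$ and $\varphi(x,t)$ are given. Solutions are understood to be regular enough that the quantities below make sense and that the equation may be multiplied by powers of $u$ and integrated by parts. Notation: $f^-=\max\{-f,0\}$; $\|\varphi^-(t)\|_{L^\infty(\Gamma)}=\|\varphi^-(\cdot,t)\|_{L^\infty(\Gamma)}$. For $\alpha>n\mu_0$: $\theta_\alpha=\frac{1}{(1-a)(\alpha/\alpha_*-1)}\in(0,1)$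 and $\mu_{1,\alpha}=\frac{\mu_0(1+\theta_\alpha(1-a))}{1-\theta_\alpha}$. Constants $C_1,C_2,C_3$: for the given $\alpha$, $C_1,C_2>0$ are constants depending only on $\alpha,\lambda,g,n,U$ such that every non-negative solution of (P) satisfies $$\frac{d}{dt}\int_U u^\alpha dx+C_1\int_U|\nabla u|^{2-a}u^{\alpha+\delta-2}dx\le C_2\Big(1+\|\varphi^-(t)\|_{L^\infty(\Gamma)}^{\frac{2-a}{(1-a)(1-\theta_\alpha)}}\Big)\Big(1+\int_Uu^\alpha dx\Big)^{1+\mu_{1,\alpha}/\alpha},$$ and $C_3=C_{3,\alpha}=C_2\mu_{1,\alpha}/\alpha$. *)

theory Defs
  imports "HOL-Analysis.Analysis"
begin

text \<open>Real powers of non-negative reals with \<open>0\<^sup>0 = 1\<close>; the library has \<open>0 powr 0 = 0\<close>, which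
  would give the wrong value of \<open>g\<close> at \<open>0\<close>.\<close>

definition rpow :: "real \<Rightarrow> real \<Rightarrow> real" where
  "rpow s p = (if p = 0 then 1 else s powr p)"

definition forchheimer_g :: "nat \<Rightarrow> (nat \<Rightarrow> real) \<Rightarrow> (nat \<Rightarrow> real) \<Rightarrow> real \<Rightarrow> real" where
  "forchheimer_g N \<gamma> c s = (\<Sum>i\<le>N. c i * rpow s (\<gamma> i))"

definition forchheimer_K :: "(real \<Rightarrow> real) \<Rightarrow> real \<Rightarrow> real" where
  "forchheimer_K g \<xi> = 1 / g (THE s. s \<ge> 0 \<and> s * g s = \<xi>)"

definition grad :: "('a::euclidean_space \<Rightarrow> real) \<Rightarrow> 'a \<Rightarrow> 'a" where
  "grad f x = (THE D. GDERIV f x :> D)"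

definition divergence :: "('a::euclidean_space \<Rightarrow> 'a) \<Rightarrow> 'a \<Rightarrow> real" where
  "divergence F x = (\<Sum>b\<in>Basis. frechet_derivative F (at x) b \<bullet> b)"

text \<open>Near the boundary point \<open>x\<close>, the set \<open>U\<close> is the region above the graph, in the direction of
  the unit vector \<open>e\<close>, of a \<open>C\<^sup>1\<close> function of the coordinates orthogonal to \<open>e\<close>; such a function
  is represented by an \<open>h\<close> on the whole space that is invariant under translation along \<open>e\<close>.\<close>

definition C1_graph_at ::
  "'a::euclidean_space set \<Rightarrow> 'a \<Rightarrow> 'a \<Rightarrow> ('a \<Rightarrow> real) \<Rightarrow> bool" where
  "C1_graph_at U x e h \<longleftrightarrow>
     norm e = 1 \<and>
     (\<forall>y s. h (y + s *\<^sub>R e) = h y) \<and>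
     (\<forall>y. GDERIV h y :> grad h y) \<and> continuous_on UNIV (grad h) \<and>
     (\<exists>r>0. U \<inter> ball x r = {y \<in> ball x r. h y < y \<bullet> e})"

definition C1_boundary :: "'a::euclidean_space set \<Rightarrow> bool" where
  "C1_boundary U \<longleftrightarrow> (\<forall>x\<in>frontier U. \<exists>e h. C1_graph_at U x e h)"

text \<open>Locally \<open>U\<close> is \<open>{y. h y - y \<bullet> e < 0}\<close>, so the normalised gradient of \<open>h y - y \<bullet> e\<close>
  points outwards; it does not depend on the choice of \<open>e\<close> and \<open>h\<close>.\<close>

definition outward_normal :: "'a::euclidean_space set \<Rightarrow> 'a \<Rightarrow> 'a" where
  "outward_normal U x = (THE v. \<exists>e h. C1_graph_at U x e h \<and> v = sgn (grad h x - e))"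

text \<open>Null sets of the \<open>(n-1)\<close>-dimensional Hausdorff measure. On a \<open>C\<^sup>1\<close> hypersurface these are the
  null sets of the surface measure. For \<open>n \<ge> 2\<close> no bound on the diameters has to be imposed,
  since a small sum forces each of them to be small.\<close>

definition surface_null :: "'a::euclidean_space set \<Rightarrow> bool" where
  "surface_null A \<longleftrightarrow>
     (\<forall>\<epsilon>>0. \<exists>S :: nat \<Rightarrow> 'a set. A \<subseteq> (\<Union>i. S i) \<and> (\<forall>i. bounded (S i)) \<and>
        summable (\<lambda>i. diameter (S i) ^ (DIM('a) - 1)) \<and>
        (\<Sum>i. diameter (S i) ^ (DIM('a) - 1)) < \<epsilon>)"

definition ess_bounds :: "'a::euclidean_space set \<Rightarrow> ('a \<Rightarrow> real) \<Rightarrow> real set" where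
  "ess_bounds \<Gamma> f = {M. M \<ge> 0 \<and> surface_null {x \<in> \<Gamma>. \<bar>f x\<bar> > M}}"

definition Linf_norm :: "'a::euclidean_space set \<Rightarrow> ('a \<Rightarrow> real) \<Rightarrow> real" where
  "Linf_norm \<Gamma> f = Inf (ess_bounds \<Gamma> f)"

definition neg_part :: "real \<Rightarrow> real" where
  "neg_part r = max (- r) 0"

text \<open>Non-negative solutions \<open>u x t\<close> of
    \<open>\<partial>\<^sub>t(u\<^sup>\<lambda>) = div (K(|\<nabla>u|) \<nabla>u)\<close> in \<open>U \<times> (0,\<infinity>)\<close>, \<open>u(\<cdot>,0) = u0\<close> in \<open>U\<close>,
    \<open>K(|\<nabla>u|) \<partial>u/\<partial>\<nu> + \<phi> u\<^sup>\<lambda> = 0\<close> on \<open>\<partial>U \<times> (0,\<infinity>)\<close>.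
  The regularity fixed here lets one multiply the equation by powers of \<open>u\<close> and integrate by parts:
  \<open>u\<close> is continuous on \<open>closure U \<times> [0,\<infinity>)\<close>, its spatial gradient extends to a continuous function
  \<open>p\<close> on \<open>closure U \<times> (0,\<infinity>)\<close> (which gives \<open>\<partial>u/\<partial>\<nu> = p \<bullet> \<nu>\<close> on the boundary), the flux is
  differentiable in \<open>U\<close>, and \<open>\<partial>\<^sub>t(u\<^sup>\<lambda>)\<close> exists and is bounded on \<open>U \<times> [t1,t2]\<close> for
  \<open>0 < t1 \<le> t2\<close>. Of \<open>\<phi>\<close> only essential boundedness of \<open>\<phi>\<^sup>-(\<cdot>,t)\<close> is required.\<close>

definition nonneg_solution ::
  "'a::euclidean_space set \<Rightarrow> (real \<Rightarrow> real) \<Rightarrow> real \<Rightarrow> ('a \<Rightarrow> real \<Rightarrow> real) \<Rightarrow> ('a \<Rightarrow> real)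
     \<Rightarrow> ('a \<Rightarrow> real \<Rightarrow> real) \<Rightarrow> bool" where
  "nonneg_solution U K lam \<phi> u0 u \<longleftrightarrow>
     (\<forall>x\<in>closure U. \<forall>t\<ge>0. u x t \<ge> 0) \<and>
     continuous_on (closure U \<times> {0..}) (\<lambda>(x, t). u x t) \<and>
     (\<forall>t>0. ess_bounds (frontier U) (\<lambda>x. neg_part (\<phi> x t)) \<noteq> {}) \<and>
     (\<forall>x\<in>U. u x 0 = u0 x) \<and>
     (\<exists>p. continuous_on (closure U \<times> {0<..}) (\<lambda>(x, t). p x t) \<and>
        (\<forall>x\<in>U. \<forall>t>0.
           (GDERIV (\<lambda>y. u y t) x :> p x t) \<and>
           (\<lambda>y. K (norm (p y t)) *\<^sub>R p y t) differentiable (at x) \<and>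
           ((\<lambda>s. u x s powr lam) has_real_derivative
              divergence (\<lambda>y. K (norm (p y t)) *\<^sub>R p y t) x) (at t)) \<and>
        (\<forall>x\<in>frontier U. \<forall>t>0.
           K (norm (p x t)) * (p x t \<bullet> outward_normal U x) + \<phi> x t * u x t powr lam = 0)) \<and>
     (\<forall>t1>0. \<forall>t2\<ge>t1. \<exists>B. \<forall>x\<in>U. \<forall>t\<in>{t1..t2}. \<bar>deriv (\<lambda>s. u x s powr lam) t\<bar> \<le> B)"

definition power_integral ::
  "'a::euclidean_space set \<Rightarrow> real \<Rightarrow> ('a \<Rightarrow> real) \<Rightarrow> real" where
  "power_integral U \<alpha> v = (LINT x:U|lebesgue. v x powr \<alpha>)"

definition gradient_integral ::
  "'a::euclidean_space set \<Rightarrow> real \<Rightarrow> real \<Rightarrow> ('a \<Rightarrow> real) \<Rightarrow> real" where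
  "gradient_integral U q r v = (LINT x:U|lebesgue. norm (grad v x) powr q * rpow (v x) r)"

definition boundary_weight ::
  "'a::euclidean_space set \<Rightarrow> ('a \<Rightarrow> real \<Rightarrow> real) \<Rightarrow> real \<Rightarrow> real \<Rightarrow> real" where
  "boundary_weight U \<phi> q t = 1 + Linf_norm (frontier U) (\<lambda>x. neg_part (\<phi> x t)) powr q"

end

theory Submission
  imports Defs
begin

text \<open>
  Put \<open>y(t) = 1 + \<integral>\<^sub>U u\<^sup>\<alpha> dx\<close>, \<open>\<kappa> = \<mu>\<^sub>1/\<alpha> > 0\<close> and let \<open>w\<close> be the boundary weight. The
  differential inequality says \<open>y' + C\<^sub>1 G \<le> C\<^sub>2 w y\<^bsup>1+\<kappa>\<^esup>\<close>, where \<open>G \<ge> 0\<close> is the gradient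
  integral. Dropping \<open>G\<close>, the function \<open>y\<^bsup>-\<kappa>\<^esup>\<close> satisfies
  \<open>(y\<^bsup>-\<kappa>\<^esup>)' = -\<kappa> y\<^bsup>-\<kappa>-1\<^esup> y' \<ge> -C\<^sub>3 w\<close>, and integration over \<open>[0,t]\<close> followed by taking the
  power \<open>-1/\<kappa>\<close> gives (i) (\<open>bernoulli_gronwall\<close>). Under the hypothesis of (ii) the same
  integrated inequality reads \<open>y(t)\<^bsup>-\<kappa>\<^esup> \<ge> (2 y(0))\<^bsup>-\<kappa>\<^esup>\<close>, so \<open>y \<le> 2 y(0)\<close>. Inserting this
  bound back and integrating the full differential inequality bounds \<open>C\<^sub>1 \<integral> G\<close> by
  \<open>C\<^sub>2 (2 y(0))\<^bsup>1+\<kappa>\<^esup> \<integral> w + y(0)\<close> (\<open>dissipation_integrable\<close>); here \<open>\<integral> w\<close> is at most a multiple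
  of \<open>y(0)\<^bsup>-\<kappa>\<^esup>\<close>, so the whole bound is linear in \<open>y(0)\<close>.

  Two points need care. First, \<open>y'\<close> is only known to exist at each \<open>t > 0\<close>; it need not be
  continuous or Lebesgue integrable. The gauge integral is made for this: it integrates every
  derivative, and inequalities between gauge integrable functions can be integrated. Second,
  the conclusion includes the Lebesgue integrability of \<open>G\<close>. Continuity of \<open>u\<close> up to
  the initial time and of its gradient at positive times make \<open>y\<close> continuous on \<open>[0,\<infinity>)\<close> and
  \<open>G\<close> continuous on \<open>(0,\<infinity>)\<close>; then \<open>G\<close> is measurable and lies between \<open>0\<close> and a gauge
  integrable function, which makes it Lebesgue integrable.
\<close>

section \<open>Continuity of integrals depending on time\<close>

text \<open>Dominated convergence: along a convergent sequence of times the integrands take their values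
  in the image of a compact set and are thus uniformly bounded on the bounded set \<open>U\<close>. The
  bound depends on the sequence, so \<open>T\<close> may be a set such as \<open>{0<..}\<close>, near whose end point
  the integrand can blow up.\<close>

lemma continuous_on_set_lebesgue_integral:
  fixes U :: "'a::euclidean_space set" and T :: "real set" and f :: "'a \<Rightarrow> real \<Rightarrow> real"
  assumes "open U" "bounded U"
    and cont: "continuous_on (closure U \<times> T) (\<lambda>(x, t). f x t)"
  shows "continuous_on T (\<lambda>t. LINT x:U|lebesgue. f x t)"
proof -
  have U: "U \<in> lmeasurable"
    using assms by (simp add: lmeasurable_open)
  interpret finite_measure "lebesgue_on U"
    using U by (rule finite_measure_lebesgue_on)
  have eq: "(LINT x:U|lebesgue. f x t) = integral\<^sup>L (lebesgue_on U) (\<lambda>x. f x t)" for t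
    using U by (simp add: set_lebesgue_integral_def integral_restrict_space fmeasurableD)
  have meas: "(\<lambda>x. f x t) \<in> borel_measurable (lebesgue_on U)" if "t \<in> T" for t
  proof (rule continuous_imp_measurable_on_sets_lebesgue)
    have "continuous_on U (\<lambda>x. case (x, t) of (x, t) \<Rightarrow> f x t)"
      by (rule continuous_on_compose2[OF cont])
        (use that closure_subset in \<open>auto intro!: continuous_intros\<close>)
    then show "continuous_on U (\<lambda>x. f x t)" by simp
  qed (use U in auto)
  have "(\<lambda>n. integral\<^sup>L (lebesgue_on U) (\<lambda>x. f x (\<tau> n)))
          \<longlonglongrightarrow> integral\<^sup>L (lebesgue_on U) (\<lambda>x. f x t)"
    if \<tau>: "\<forall>n. \<tau> n \<in> T" "t \<in> T" "\<tau> \<longlonglongrightarrow> t" for \<tau> t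
  proof -
    have "compact (closure U \<times> insert t (range \<tau>))"
      using assms \<tau> by (intro compact_Times compact_sequence_with_limit) (auto simp: compact_closure)
    moreover have "continuous_on (closure U \<times> insert t (range \<tau>)) (\<lambda>(x, t). f x t)"
      using \<tau> by (intro continuous_on_subset[OF cont]) auto
    ultimately have "bounded ((\<lambda>(x, t). f x t) ` (closure U \<times> insert t (range \<tau>)))"
      by (intro compact_imp_bounded compact_continuous_image)
    then obtain B where B: "\<And>x s. x \<in> closure U \<Longrightarrow> s \<in> insert t (range \<tau>) \<Longrightarrow> \<bar>f x s\<bar> \<le> B"
      unfolding bounded_iff by fastforce
    show ?thesis
    proof (rule integral_dominated_convergence[where w = "\<lambda>_. B"])
      show "AE x in lebesgue_on U. (\<lambda>n. f x (\<tau> n)) \<longlonglongrightarrow> f x t"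
      proof (rule AE_I2)
        fix x assume "x \<in> space (lebesgue_on U)"
        then have x: "x \<in> closure U"
          using closure_subset by auto
        have "continuous_on T (\<lambda>s. case (x, s) of (x, t) \<Rightarrow> f x t)"
          by (rule continuous_on_compose2[OF cont]) (use x in \<open>auto intro!: continuous_intros\<close>)
        then have "continuous_on T (f x)" by simp
        then show "(\<lambda>n. f x (\<tau> n)) \<longlonglongrightarrow> f x t"
          using \<tau> unfolding continuous_on_sequentially by (auto simp: o_def)
      qed
      show "AE x in lebesgue_on U. norm (f x (\<tau> n)) \<le> B" for n
      proof (rule AE_I2)
        fix x assume "x \<in> space (lebesgue_on U)"
        then have "x \<in> closure U"
          using closure_subset by auto
        then show "norm (f x (\<tau> n)) \<le> B"
          using B by simp
      qed
    qed (use \<tau> meas in auto)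
  qed
  then show ?thesis
    unfolding continuous_on_sequentially eq by (auto simp: o_def)
qed

lemma grad_eqI:
  assumes "GDERIV f x :> D"
  shows "grad f x = D"
  unfolding grad_def
proof (rule the_equality)
  fix E assume "GDERIV f x :> E"
  then have "(\<lambda>h. h \<bullet> E) = (\<lambda>h. h \<bullet> D)"
    using assms unfolding gderiv_def by (rule has_derivative_unique)
  then show "E = D"
    by (simp add: fun_eq_iff vector_eq_ldot)
qed (rule assms)

lemma continuous_on_rpow:
  assumes "continuous_on S f" "\<And>x. x \<in> S \<Longrightarrow> f x \<ge> 0" "r \<ge> 0"
  shows "continuous_on S (\<lambda>x. rpow (f x) r)"
proof (cases "r = 0")
  case False
  then have "continuous_on S (\<lambda>x. f x powr r)"
    using assms by (intro continuous_on_powr' continuous_on_const) auto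
  with False show ?thesis
    by (simp add: rpow_def)
qed (simp add: rpow_def)

lemma rpow_nonneg: "rpow s r \<ge> 0"
  by (simp add: rpow_def)

lemma power_integral_nonneg: "power_integral U \<alpha> v \<ge> 0"
  unfolding power_integral_def set_lebesgue_integral_def
  by (intro Bochner_Integration.integral_nonneg) (auto simp: indicator_def)

lemma gradient_integral_nonneg: "gradient_integral U p r v \<ge> 0"
  unfolding gradient_integral_def set_lebesgue_integral_def
  by (intro Bochner_Integration.integral_nonneg) (auto simp: indicator_def rpow_nonneg)

lemma boundary_weight_nonneg: "boundary_weight U \<phi> q t \<ge> 0"
  by (simp add: boundary_weight_def)

lemma power_integral_cong:
  assumes "open U" "\<And>x. x \<in> U \<Longrightarrow> v x = w x"
  shows "power_integral U \<alpha> v = power_integral U \<alpha> w"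
  unfolding power_integral_def
  by (rule set_lebesgue_integral_cong) (use assms in auto)

lemma nonneg_solution_continuous_power_integral:
  assumes "open U" "bounded U" "\<alpha> > 0" and sol: "nonneg_solution U K lam \<phi> u0 u"
  shows "continuous_on {0..} (\<lambda>t. power_integral U \<alpha> (\<lambda>x. u x t))"
  unfolding power_integral_def
proof (rule continuous_on_set_lebesgue_integral)
  have "continuous_on (closure U \<times> {0..}) (\<lambda>(x, t). u x t)"
    and "\<forall>x\<in>closure U. \<forall>t\<ge>0. u x t \<ge> 0"
    using sol by (auto simp: nonneg_solution_def)
  then show "continuous_on (closure U \<times> {0..}) (\<lambda>(x, t). u x t powr \<alpha>)"
    unfolding case_prod_unfold using \<open>\<alpha> > 0\<close>
    by (intro continuous_on_powr') auto
qed fact+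

text \<open>The gradient itself is only defined on \<open>U\<close>. The estimate of the integrand near the boundary
  comes from the continuous extension \<open>p\<close> of the gradient to \<open>closure U\<close>.\<close>

lemma nonneg_solution_continuous_gradient_integral:
  assumes "open U" "bounded U" "s > 0" "r \<ge> 0" and sol: "nonneg_solution U K lam \<phi> u0 u"
  shows "continuous_on {0<..} (\<lambda>t. gradient_integral U s r (\<lambda>x. u x t))"
proof -
  have u: "continuous_on (closure U \<times> {0..}) (\<lambda>(x, t). u x t)"
    and nonneg: "\<forall>x\<in>closure U. \<forall>t\<ge>0. u x t \<ge> 0"
    using sol by (auto simp: nonneg_solution_def)
  obtain p where p: "continuous_on (closure U \<times> {0<..}) (\<lambda>(x, t). p x t)"
    and grad: "\<And>x t. x \<in> U \<Longrightarrow> t > 0 \<Longrightarrow> GDERIV (\<lambda>y. u y t) x :> p x t"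
    using sol unfolding nonneg_solution_def by blast
  have "continuous_on (closure U \<times> {0<..}) (\<lambda>(x, t). u x t)"
    by (rule continuous_on_subset[OF u]) auto
  with p have "continuous_on (closure U \<times> {0<..}) (\<lambda>(x, t). norm (p x t) powr s * rpow (u x t) r)"
    unfolding case_prod_unfold using \<open>s > 0\<close> \<open>r \<ge> 0\<close> nonneg
    by (intro continuous_on_mult continuous_on_powr' continuous_on_rpow continuous_on_norm) auto
  then have "continuous_on {0<..} (\<lambda>t. LINT x:U|lebesgue. norm (p x t) powr s * rpow (u x t) r)"
    by (rule continuous_on_set_lebesgue_integral[OF assms(1,2)])
  moreover have "gradient_integral U s r (\<lambda>x. u x t)
      = (LINT x:U|lebesgue. norm (p x t) powr s * rpow (u x t) r)" if "t > 0" for t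
    unfolding gradient_integral_def
    by (rule set_lebesgue_integral_cong) (use that assms(1) in \<open>auto simp: grad_eqI[OF grad]\<close>)
  ultimately show ?thesis
    by (subst continuous_on_cong[OF refl]) auto
qed

section \<open>Two integrated differential inequalities\<close>

text \<open>The substitution \<open>z = y\<^bsup>-\<kappa>\<^esup>\<close> turns the Bernoulli inequality \<open>y' \<le> C w y\<^bsup>1+\<kappa>\<^esup>\<close> into
  \<open>z' \<ge> -\<kappa> C w\<close>. Both sides are gauge integrable, the left one as a derivative.\<close>

lemma bernoulli_gronwall:
  fixes y w D :: "real \<Rightarrow> real"
  assumes "0 \<le> t" "\<kappa> \<ge> 0"
    and cont: "continuous_on {0..t} y" and pos: "\<And>s. s \<in> {0..t} \<Longrightarrow> y s > 0"
    and deriv: "\<And>s. s \<in> {0<..<t} \<Longrightarrow> (y has_real_derivative D s) (at s)"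
    and le: "\<And>s. s \<in> {0<..<t} \<Longrightarrow> D s \<le> C * w s * y s powr (1 + \<kappa>)"
    and w: "w integrable_on {0..t}"
  shows "y 0 powr (- \<kappa>) - \<kappa> * C * integral {0..t} w \<le> y t powr (- \<kappa>)"
proof -
  have "((\<lambda>s. - \<kappa> * y s powr (- \<kappa> - 1) * D s) has_integral
          (y t powr (- \<kappa>) - y 0 powr (- \<kappa>))) {0..t}"
  proof (rule fundamental_theorem_of_calculus_interior[where f = "\<lambda>s. y s powr (- \<kappa>)"])
    show "continuous_on {0..t} (\<lambda>s. y s powr (- \<kappa>))"
      using pos by (intro continuous_on_powr cont continuous_on_const) force
    show "((\<lambda>s. y s powr (- \<kappa>)) has_vector_derivative - \<kappa> * y s powr (- \<kappa> - 1) * D s) (at s)"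
      if "s \<in> {0<..<t}" for s
      using DERIV_fun_powr[OF deriv[OF that], of "- \<kappa>"] pos[of s] that
      by (simp add: has_real_derivative_iff_has_vector_derivative)
  qed fact
  then have L: "((\<lambda>s. - \<kappa> * y s powr (- \<kappa> - 1) * D s) has_integral
          (y t powr (- \<kappa>) - y 0 powr (- \<kappa>))) {0<..<t}"
    by (simp add: has_integral_Icc_iff_Ioo)
  have "((\<lambda>s. - (\<kappa> * C) * w s) has_integral - (\<kappa> * C) * integral {0..t} w) {0..t}"
    by (intro has_integral_mult_right integrable_integral w)
  then have R: "((\<lambda>s. - (\<kappa> * C) * w s) has_integral - (\<kappa> * C) * integral {0..t} w) {0<..<t}"
    by (simp only: has_integral_Icc_iff_Ioo)
  have "- (\<kappa> * C) * integral {0..t} w \<le> y t powr (- \<kappa>) - y 0 powr (- \<kappa>)"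
  proof (rule has_integral_le[OF R L])
    fix s assume s: "s \<in> {0<..<t}"
    have "y s > 0"
      using pos s by simp
    have "\<kappa> * y s powr (- \<kappa> - 1) * D s
        \<le> \<kappa> * y s powr (- \<kappa> - 1) * (C * w s * y s powr (1 + \<kappa>))"
      using le[OF s] \<open>\<kappa> \<ge> 0\<close> by (intro mult_left_mono) auto
    also have "\<dots> = \<kappa> * C * w s * (y s powr (- \<kappa> - 1) * y s powr (1 + \<kappa>))"
      by (simp add: algebra_simps)
    also have "y s powr (- \<kappa> - 1) * y s powr (1 + \<kappa>) = 1"
      using \<open>y s > 0\<close> by (simp flip: powr_add)
    finally show "- (\<kappa> * C) * w s \<le> - \<kappa> * y s powr (- \<kappa> - 1) * D s"
      by simp
  qed
  then show ?thesis by simp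
qed

text \<open>Since \<open>y'\<close> is a derivative, \<open>M w - y'\<close> is gauge integrable. It dominates the continuous
  function \<open>C\<^sub>1 G \<ge> 0\<close>, and a non-negative measurable function below a gauge integrable one is
  Lebesgue integrable. Working on the open interval keeps the values of \<open>G\<close> at the endpoints
  out of the hypotheses: for a solution the gradient is uncontrolled at time \<open>0\<close>.\<close>

lemma dissipation_integrable:
  fixes y w D G :: "real \<Rightarrow> real"
  assumes "0 \<le> T" "C\<^sub>1 > 0"
    and cont: "continuous_on {0..T} y"
    and deriv: "\<And>s. s \<in> {0<..<T} \<Longrightarrow> (y has_real_derivative D s) (at s)"
    and contG: "continuous_on {0<..<T} G" and nonneg: "\<And>s. s \<in> {0<..<T} \<Longrightarrow> G s \<ge> 0"
    and le: "\<And>s. s \<in> {0<..<T} \<Longrightarrow> D s + C\<^sub>1 * G s \<le> M * w s"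
    and w: "w integrable_on {0..T}"
  shows "set_integrable lebesgue {0..T} G"
    and "C\<^sub>1 * (LINT t:{0..T}|lebesgue. G t) \<le> M * integral {0..T} w + y 0 - y T"
proof -
  have "(D has_integral (y T - y 0)) {0..T}"
    using deriv
    by (intro fundamental_theorem_of_calculus_interior[where f = y] assms(1) cont)
      (simp add: has_real_derivative_iff_has_vector_derivative)
  from has_integral_diff[OF has_integral_mult_right[OF integrable_integral[OF w], of M] this]
  have R: "((\<lambda>s. M * w s - D s) has_integral (M * integral {0..T} w - (y T - y 0))) {0<..<T}"
    by (simp only: has_integral_Icc_iff_Ioo)
  have "(\<lambda>s. C\<^sub>1 * G s) absolutely_integrable_on {0<..<T}"
  proof (rule measurable_bounded_by_integrable_imp_absolutely_integrable)
    show "(\<lambda>s. C\<^sub>1 * G s) \<in> borel_measurable (lebesgue_on {0<..<T})"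
      by (intro continuous_imp_measurable_on_sets_lebesgue continuous_on_mult contG) auto
    show "(\<lambda>s. M * w s - D s) integrable_on {0<..<T}"
      using R by (rule has_integral_integrable)
    show "norm (C\<^sub>1 * G s) \<le> M * w s - D s" if "s \<in> {0<..<T}" for s
      using le[OF that] nonneg[OF that] \<open>C\<^sub>1 > 0\<close> by simp
  qed simp
  then have "(\<lambda>s. inverse C\<^sub>1 * (C\<^sub>1 * G s)) absolutely_integrable_on {0<..<T}"
    by (rule set_integrable_mult_right)
  then have "G absolutely_integrable_on {0<..<T}"
    using \<open>C\<^sub>1 > 0\<close> by (simp add: mult.assoc[symmetric])
  then show G: "G absolutely_integrable_on {0..T}"
    by (simp add: absolutely_integrable_on_Icc_iff_Ioo)
  have "(G has_integral (LINT t:{0..T}|lebesgue. G t)) {0..T}"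
    by (rule has_integral_set_lebesgue[OF G])
  then have "((\<lambda>s. C\<^sub>1 * G s) has_integral C\<^sub>1 * (LINT t:{0..T}|lebesgue. G t)) {0<..<T}"
    by (subst has_integral_Icc_iff_Ioo[symmetric]) (rule has_integral_mult_right)
  then have "C\<^sub>1 * (LINT t:{0..T}|lebesgue. G t) \<le> M * integral {0..T} w - (y T - y 0)"
    by (rule has_integral_le[OF _ R]) (use le in force)
  then show "C\<^sub>1 * (LINT t:{0..T}|lebesgue. G t) \<le> M * integral {0..T} w + y 0 - y T"
    by simp
qed

section \<open>The estimates for solutions\<close>

text \<open>The condition \<open>\<alpha> > n \<mu>\<^sub>0\<close> is equivalent to \<open>(1 - a) (\<alpha>/\<alpha>\<^sub>* - 1) > 1\<close>, which
  is what puts \<open>\<theta>\<close> into \<open>(0,1)\<close>.\<close>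

lemma exponents_pos:
  fixes n a \<delta> \<alpha> :: real
  assumes "n > 0" "\<delta> < a" "a < 1"
    and \<alpha>s: "\<alpha>s = n * (a - \<delta>) / (2 - a)" and \<mu>\<^sub>0: "\<mu>\<^sub>0 = (a - \<delta>) / (1 - a)" and "\<alpha> > n * \<mu>\<^sub>0"
    and \<theta>: "\<theta> = 1 / ((1 - a) * (\<alpha> / \<alpha>s - 1))" and \<mu>\<^sub>1: "\<mu>\<^sub>1 = \<mu>\<^sub>0 * (1 + \<theta> * (1 - a)) / (1 - \<theta>)"
  shows "\<mu>\<^sub>1 > 0"
proof -
  have "\<alpha>s > 0"
    using assms by simp
  have "\<alpha> > (2 - a) / (1 - a) * \<alpha>s"
    using \<open>\<alpha> > n * \<mu>\<^sub>0\<close> \<open>a < 1\<close> unfolding \<alpha>s \<mu>\<^sub>0 by simp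
  then have "(2 - a) / (1 - a) < \<alpha> / \<alpha>s"
    using \<open>\<alpha>s > 0\<close> by (simp add: pos_less_divide_eq)
  then have "(1 - a) * (\<alpha> / \<alpha>s - 1) > 1"
    using \<open>a < 1\<close> by (simp add: divide_less_eq algebra_simps)
  then have "0 < \<theta>" "\<theta> < 1"
    unfolding \<theta> by (auto simp: divide_less_eq)
  moreover have "\<mu>\<^sub>0 > 0"
    using assms by simp
  ultimately show ?thesis
    unfolding \<mu>\<^sub>1 using \<open>a < 1\<close> by (simp add: add_pos_pos)
qed

theorem theorem3p3:
  fixes U :: "(real ^ 'n) set"
    and N :: nat and \<gamma> c :: "nat \<Rightarrow> real"
    and lam a \<delta> \<alpha>s \<mu>\<^sub>0 \<alpha> \<theta> \<mu>\<^sub>1 q C\<^sub>1 C\<^sub>2 C\<^sub>3 :: real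
    and g K :: "real \<Rightarrow> real"
  assumes "CARD('n) \<ge> 2"
    and "open U" and "bounded U" and "C1_boundary U"
    and "N \<ge> 1" and "\<gamma> 0 = 0" and "\<And>i. i < N \<Longrightarrow> \<gamma> i < \<gamma> (Suc i)"
    and "\<And>i. i \<le> N \<Longrightarrow> c i > 0"
    and "g = forchheimer_g N \<gamma> c" and "K = forchheimer_K g"
    and "a = \<gamma> N / (\<gamma> N + 1)"
    and "0 < lam" and "lam \<le> 1" and "\<delta> = 1 - lam" and "a > \<delta>"
    and "\<alpha>s = real CARD('n) * (a - \<delta>) / (2 - a)"
    and "\<mu>\<^sub>0 = (a - \<delta>) / (1 - a)"
    and "\<alpha> \<ge> 2 - \<delta>" and "\<alpha> > real CARD('n) * \<mu>\<^sub>0"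
    and "\<theta> = 1 / ((1 - a) * (\<alpha> / \<alpha>s - 1))"
    and "\<mu>\<^sub>1 = \<mu>\<^sub>0 * (1 + \<theta> * (1 - a)) / (1 - \<theta>)"
    and "q = (2 - a) / ((1 - a) * (1 - \<theta>))"
    and "C\<^sub>1 > 0" and "C\<^sub>2 > 0"
    and "\<And>\<phi> u0 u t. nonneg_solution U K lam \<phi> u0 u \<Longrightarrow> t > 0 \<Longrightarrow>
           (\<lambda>s. power_integral U \<alpha> (\<lambda>x. u x s)) differentiable (at t) \<and>
           deriv (\<lambda>s. power_integral U \<alpha> (\<lambda>x. u x s)) t
             + C\<^sub>1 * gradient_integral U (2 - a) (\<alpha> + \<delta> - 2) (\<lambda>x. u x t)
           \<le> C\<^sub>2 * boundary_weight U \<phi> q t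
               * (1 + power_integral U \<alpha> (\<lambda>x. u x t)) powr (1 + \<mu>\<^sub>1 / \<alpha>)"
    and "C\<^sub>3 = C\<^sub>2 * \<mu>\<^sub>1 / \<alpha>"
  shows "(\<forall>\<phi> u0 u T. nonneg_solution U K lam \<phi> u0 u \<and> T > 0 \<and>
            set_integrable lebesgue {0..T} (boundary_weight U \<phi> q) \<and>
            (LINT t:{0..T}|lebesgue. boundary_weight U \<phi> q t)
              < 1 / C\<^sub>3 * (1 + power_integral U \<alpha> u0) powr (- (\<mu>\<^sub>1 / \<alpha>)) \<longrightarrow>
            (\<forall>t\<in>{0<..T}. power_integral U \<alpha> (\<lambda>x. u x t)
               \<le> ((1 + power_integral U \<alpha> u0) powr (- (\<mu>\<^sub>1 / \<alpha>))
                   - C\<^sub>3 * (LINT \<tau>:{0..t}|lebesgue. boundary_weight U \<phi> q \<tau>))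
                  powr (- (\<alpha> / \<mu>\<^sub>1)))) \<and>
         (\<exists>C>0. \<forall>\<phi> u0 u T. nonneg_solution U K lam \<phi> u0 u \<and> T > 0 \<and>
            set_integrable lebesgue {0..T} (boundary_weight U \<phi> q) \<and>
            (LINT t:{0..T}|lebesgue. boundary_weight U \<phi> q t)
              \<le> (1 - 2 powr (- (\<mu>\<^sub>1 / \<alpha>))) / C\<^sub>3
                  * (1 + power_integral U \<alpha> u0) powr (- (\<mu>\<^sub>1 / \<alpha>)) \<longrightarrow>
            (\<forall>t\<in>{0<..T}. power_integral U \<alpha> (\<lambda>x. u x t) \<le> 2 * (1 + power_integral U \<alpha> u0)) \<and>
            set_integrable lebesgue {0..T}
              (\<lambda>t. gradient_integral U (2 - a) (\<alpha> + \<delta> - 2) (\<lambda>x. u x t)) \<and>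
            (LINT t:{0..T}|lebesgue. gradient_integral U (2 - a) (\<alpha> + \<delta> - 2) (\<lambda>x. u x t))
              \<le> C * (1 + power_integral U \<alpha> u0))"
proof -
  define \<kappa> where "\<kappa> = \<mu>\<^sub>1 / \<alpha>"
  have "i < N \<Longrightarrow> \<gamma> 0 < \<gamma> (Suc i)" for i
    by (induction i) (use assms(7) in \<open>fastforce intro: less_trans\<close>)+
  from this[of "N - 1"] have "\<gamma> N > 0"
    using \<open>N \<ge> 1\<close> \<open>\<gamma> 0 = 0\<close> by simp
  then have a: "a < 1"
    using \<open>a = \<gamma> N / (\<gamma> N + 1)\<close> by (simp add: divide_less_eq)
  have "\<alpha> > 0"
    using assms by linarith
  have "\<mu>\<^sub>1 > 0"
    by (rule exponents_pos[of "real CARD('n)" \<delta> a \<alpha>s \<mu>\<^sub>0 \<alpha> \<theta>]) (use assms a in auto)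
  have \<kappa>: "\<kappa> > 0"
    using \<open>\<alpha> > 0\<close> \<open>\<mu>\<^sub>1 > 0\<close> by (simp add: \<kappa>_def)
  have C3: "C\<^sub>3 = \<kappa> * C\<^sub>2" "C\<^sub>3 > 0"
    using assms(26) \<open>C\<^sub>2 > 0\<close> \<open>\<alpha> > 0\<close> \<open>\<mu>\<^sub>1 > 0\<close> by (simp_all add: \<kappa>_def)
  have inv_\<kappa>: "\<alpha> / \<mu>\<^sub>1 = 1 / \<kappa>"
    by (simp add: \<kappa>_def)
  note diff_ineq = assms(25)
  let ?w = "\<lambda>\<phi>. boundary_weight U \<phi> q"
  let ?y = "\<lambda>u t. 1 + power_integral U \<alpha> (\<lambda>x. u x t)"
  let ?G = "\<lambda>u t. gradient_integral U (2 - a) (\<alpha> + \<delta> - 2) (\<lambda>x. u x t)"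

  have y_ge: "?y u t \<ge> 1" for u t
    using power_integral_nonneg[of U \<alpha>] by simp
  have y_cont: "continuous_on {0..T} (?y u)" if "nonneg_solution U K lam \<phi> u0 u" for \<phi> u0 u T
    by (intro continuous_on_add continuous_on_const
        continuous_on_subset[OF nonneg_solution_continuous_power_integral[OF assms(2,3) \<open>\<alpha> > 0\<close> that]])
      auto
  have y_init: "?y u 0 = 1 + power_integral U \<alpha> u0" if "nonneg_solution U K lam \<phi> u0 u" for \<phi> u0 u
    using that assms(2) by (auto simp: nonneg_solution_def intro: power_integral_cong)
  have y_deriv: "(?y u has_real_derivative deriv (\<lambda>s. power_integral U \<alpha> (\<lambda>x. u x s)) t) (at t)"
    and y_le: "deriv (\<lambda>s. power_integral U \<alpha> (\<lambda>x. u x s)) t + C\<^sub>1 * ?G u t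
                 \<le> C\<^sub>2 * ?w \<phi> t * ?y u t powr (1 + \<kappa>)"
    if "nonneg_solution U K lam \<phi> u0 u" "t > 0" for \<phi> u0 u t
  proof -
    have "((\<lambda>s. power_integral U \<alpha> (\<lambda>x. u x s)) has_real_derivative
        deriv (\<lambda>s. power_integral U \<alpha> (\<lambda>x. u x s)) t) (at t)"
      using diff_ineq[OF that] DERIV_deriv_iff_real_differentiable by blast
    from DERIV_add[OF DERIV_const this]
    show "(?y u has_real_derivative deriv (\<lambda>s. power_integral U \<alpha> (\<lambda>x. u x s)) t) (at t)"
      by simp
    show "deriv (\<lambda>s. power_integral U \<alpha> (\<lambda>x. u x s)) t + C\<^sub>1 * ?G u t
                 \<le> C\<^sub>2 * ?w \<phi> t * ?y u t powr (1 + \<kappa>)"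
      using diff_ineq[OF that] by (simp add: \<kappa>_def)
  qed

  have key: "(1 + power_integral U \<alpha> u0) powr (- \<kappa>) - C\<^sub>3 * (LINT \<tau>:{0..t}|lebesgue. ?w \<phi> \<tau>)
               \<le> ?y u t powr (- \<kappa>)"
    and mono: "(LINT \<tau>:{0..t}|lebesgue. ?w \<phi> \<tau>) \<le> (LINT \<tau>:{0..T}|lebesgue. ?w \<phi> \<tau>)"
    if sol: "nonneg_solution U K lam \<phi> u0 u" and w: "set_integrable lebesgue {0..T} (?w \<phi>)"
      and t: "t \<in> {0..T}" for \<phi> u0 u T t
  proof -
    have wt: "set_integrable lebesgue {0..t} (?w \<phi>)"
      by (rule set_integrable_subset[OF w]) (use t in auto)
    note int_w = set_lebesgue_integral_eq_integral[OF w]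
    note int_wt = set_lebesgue_integral_eq_integral[OF wt]
    have "?y u 0 powr (- \<kappa>) - \<kappa> * C\<^sub>2 * integral {0..t} (?w \<phi>) \<le> ?y u t powr (- \<kappa>)"
    proof (rule bernoulli_gronwall)
      show "continuous_on {0..t} (?y u)"
        by (rule y_cont[OF sol])
      show "?y u s > 0" for s
        using y_ge[of u s] by linarith
      fix s assume s: "s \<in> {0<..<t}"
      show "(?y u has_real_derivative deriv (\<lambda>s. power_integral U \<alpha> (\<lambda>x. u x s)) s) (at s)"
        using y_deriv[OF sol] s by simp
      have "C\<^sub>1 * ?G u s \<ge> 0"
        using \<open>C\<^sub>1 > 0\<close> by (simp add: gradient_integral_nonneg)
      then show "deriv (\<lambda>s. power_integral U \<alpha> (\<lambda>x. u x s)) s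
          \<le> C\<^sub>2 * ?w \<phi> s * ?y u s powr (1 + \<kappa>)"
        using y_le[OF sol, of s] s by simp
    qed (use t \<kappa> int_wt in auto)
    then show "(1 + power_integral U \<alpha> u0) powr (- \<kappa>) - C\<^sub>3 * (LINT \<tau>:{0..t}|lebesgue. ?w \<phi> \<tau>)
        \<le> ?y u t powr (- \<kappa>)"
      using y_init[OF sol] C3(1) int_wt(2) by simp
    show "(LINT \<tau>:{0..t}|lebesgue. ?w \<phi> \<tau>) \<le> (LINT \<tau>:{0..T}|lebesgue. ?w \<phi> \<tau>)"
      unfolding int_w(2) int_wt(2)
      by (rule integral_subset_le) (use t int_w int_wt in \<open>auto simp: boundary_weight_nonneg\<close>)
  qed

  \<comment> \<open>Only a positive lower bound for \<open>Y\<^bsup>-\<kappa>\<^esup>\<close> can be turned into an upper bound for \<open>Y\<close>; the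
    smallness of \<open>\<integral> w\<close> serves to make it positive.\<close>
  have invert: "Y \<le> z powr (- (1 / \<kappa>))" if "0 < z" "z \<le> Y powr (- \<kappa>)" "Y \<ge> 1" for Y z :: real
  proof -
    have "(Y powr (- \<kappa>)) powr (- (1 / \<kappa>)) \<le> z powr (- (1 / \<kappa>))"
      using that \<kappa> by (intro powr_mono2') auto
    moreover have "(Y powr (- \<kappa>)) powr (- (1 / \<kappa>)) = Y"
      using \<kappa> \<open>Y \<ge> 1\<close> by (simp add: powr_powr)
    ultimately show ?thesis by simp
  qed

  have part1: "power_integral U \<alpha> (\<lambda>x. u x t)
               \<le> ((1 + power_integral U \<alpha> u0) powr (- \<kappa>)
                   - C\<^sub>3 * (LINT \<tau>:{0..t}|lebesgue. ?w \<phi> \<tau>)) powr (- (1 / \<kappa>))"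
    if sol: "nonneg_solution U K lam \<phi> u0 u" and w: "set_integrable lebesgue {0..T} (?w \<phi>)"
      and small: "(LINT t:{0..T}|lebesgue. ?w \<phi> t)
          < 1 / C\<^sub>3 * (1 + power_integral U \<alpha> u0) powr (- \<kappa>)"
      and t: "t \<in> {0<..T}" for \<phi> u0 u T t
  proof -
    have t': "t \<in> {0..T}"
      using t by auto
    have "C\<^sub>3 * (LINT \<tau>:{0..t}|lebesgue. ?w \<phi> \<tau>) < (1 + power_integral U \<alpha> u0) powr (- \<kappa>)"
      using le_less_trans[OF mono[OF sol w t'] small] C3(2)
      by (simp add: pos_less_divide_eq mult.commute)
    then have "?y u t \<le> ((1 + power_integral U \<alpha> u0) powr (- \<kappa>)
                   - C\<^sub>3 * (LINT \<tau>:{0..t}|lebesgue. ?w \<phi> \<tau>)) powr (- (1 / \<kappa>))"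
      by (intro invert[OF _ key[OF sol w t'] y_ge[of u t]]) simp
    then show ?thesis by simp
  qed

  \<comment> \<open>The constant results from \<open>C\<^sub>1 \<integral> G \<le> C\<^sub>2 (2 y(0))\<^bsup>1+\<kappa>\<^esup> \<integral> w + y(0)\<close> and
    \<open>\<integral> w \<le> (1 - 2\<^bsup>-\<kappa>\<^esup>)/C\<^sub>3 y(0)\<^bsup>-\<kappa>\<^esup>\<close>.\<close>
  define C where "C = (C\<^sub>2 * 2 powr (1 + \<kappa>) * ((1 - 2 powr (- \<kappa>)) / C\<^sub>3) + 1) / C\<^sub>1"
  have two: "2 powr (- \<kappa>) < 1"
    using \<kappa> by (simp add: powr_less_one)
  then have "C > 0"
    unfolding C_def using C3(2) \<open>C\<^sub>1 > 0\<close> \<open>C\<^sub>2 > 0\<close>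
    by (intro divide_pos_pos add_nonneg_pos) auto

  have part2: "(\<forall>t\<in>{0<..T}. power_integral U \<alpha> (\<lambda>x. u x t) \<le> 2 * (1 + power_integral U \<alpha> u0)) \<and>
            set_integrable lebesgue {0..T} (?G u) \<and>
            (LINT t:{0..T}|lebesgue. ?G u t) \<le> C * (1 + power_integral U \<alpha> u0)"
    if sol: "nonneg_solution U K lam \<phi> u0 u" and T: "T > 0"
      and w: "set_integrable lebesgue {0..T} (?w \<phi>)"
      and small: "(LINT t:{0..T}|lebesgue. ?w \<phi> t)
          \<le> (1 - 2 powr (- \<kappa>)) / C\<^sub>3 * (1 + power_integral U \<alpha> u0) powr (- \<kappa>)" for \<phi> u0 u T
  proof -
    define Y where "Y = 1 + power_integral U \<alpha> u0"
    have Y: "Y > 0"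
      using power_integral_nonneg[of U \<alpha> u0] by (simp add: Y_def)
    note int_w = set_lebesgue_integral_eq_integral[OF w]
    have bound: "?y u t \<le> 2 * Y" if t: "t \<in> {0..T}" for t
    proof -
      have "C\<^sub>3 * (LINT \<tau>:{0..t}|lebesgue. ?w \<phi> \<tau>) \<le> (1 - 2 powr (- \<kappa>)) * Y powr (- \<kappa>)"
        using order_trans[OF mono[OF sol w t] small] C3(2)
        by (simp add: pos_le_divide_eq mult.commute Y_def)
      then have "2 powr (- \<kappa>) * Y powr (- \<kappa>) \<le> ?y u t powr (- \<kappa>)"
        using key[OF sol w t] by (simp add: Y_def[symmetric] left_diff_distrib)
      then have "(2 * Y) powr (- \<kappa>) \<le> ?y u t powr (- \<kappa>)"
        using Y by (simp add: powr_mult)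
      with invert[of "(2 * Y) powr (- \<kappa>)" "?y u t"] y_ge[of u t] show ?thesis
        using Y \<kappa> by (simp add: powr_powr)
    qed
    have G_cont: "continuous_on {0<..<T} (?G u)"
      by (rule continuous_on_subset[OF nonneg_solution_continuous_gradient_integral[OF assms(2,3) _ _ sol]])
        (use a \<open>\<alpha> \<ge> 2 - \<delta>\<close> in auto)
    have le: "deriv (\<lambda>s. power_integral U \<alpha> (\<lambda>x. u x s)) s + C\<^sub>1 * ?G u s
        \<le> C\<^sub>2 * (2 * Y) powr (1 + \<kappa>) * ?w \<phi> s" if s: "s \<in> {0<..<T}" for s
    proof -
      have "?y u s powr (1 + \<kappa>) \<le> (2 * Y) powr (1 + \<kappa>)"
        using bound[of s] s \<kappa> y_ge[of u s] by (intro powr_mono2) auto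
      then have "C\<^sub>2 * ?w \<phi> s * ?y u s powr (1 + \<kappa>) \<le> C\<^sub>2 * ?w \<phi> s * (2 * Y) powr (1 + \<kappa>)"
        using \<open>C\<^sub>2 > 0\<close> by (intro mult_left_mono) (auto simp: boundary_weight_nonneg)
      with y_le[OF sol, of s] s show ?thesis
        by (simp add: algebra_simps)
    qed
    have deriv: "(?y u has_real_derivative deriv (\<lambda>s. power_integral U \<alpha> (\<lambda>x. u x s)) s) (at s)"
      if "s \<in> {0<..<T}" for s
      using y_deriv[OF sol] that by simp
    note dissipation = dissipation_integrable[OF less_imp_le[OF T] \<open>C\<^sub>1 > 0\<close> y_cont[OF sol] deriv
        G_cont gradient_integral_nonneg le int_w(1)]
    have "C\<^sub>1 * (LINT t:{0..T}|lebesgue. ?G u t)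
        \<le> C\<^sub>2 * (2 * Y) powr (1 + \<kappa>) * integral {0..T} (?w \<phi>) + ?y u 0 - ?y u T"
      by (rule dissipation(2))
    also have "\<dots> \<le> C\<^sub>2 * (2 * Y) powr (1 + \<kappa>) * integral {0..T} (?w \<phi>) + Y"
      using y_init[OF sol] y_ge[of u T] by (simp add: Y_def)
    also have "\<dots> \<le> C\<^sub>2 * (2 * Y) powr (1 + \<kappa>) * ((1 - 2 powr (- \<kappa>)) / C\<^sub>3 * Y powr (- \<kappa>)) + Y"
      using small \<open>C\<^sub>2 > 0\<close> unfolding int_w(2) Y_def
      by (intro add_right_mono mult_left_mono) auto
    also have "\<dots> = C\<^sub>2 * 2 powr (1 + \<kappa>) * ((1 - 2 powr (- \<kappa>)) / C\<^sub>3)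
        * (Y powr (1 + \<kappa>) * Y powr (- \<kappa>)) + Y"
      using Y by (simp add: powr_mult mult_ac)
    also have "Y powr (1 + \<kappa>) * Y powr (- \<kappa>) = Y"
      using Y by (simp flip: powr_add)
    also have "C\<^sub>2 * 2 powr (1 + \<kappa>) * ((1 - 2 powr (- \<kappa>)) / C\<^sub>3) * Y + Y = C\<^sub>1 * (C * Y)"
      using \<open>C\<^sub>1 > 0\<close> by (simp add: C_def distrib_right)
    finally have "(LINT t:{0..T}|lebesgue. ?G u t) \<le> C * Y"
      using \<open>C\<^sub>1 > 0\<close> by simp
    moreover have "power_integral U \<alpha> (\<lambda>x. u x t) \<le> 2 * Y" if "t \<in> {0<..T}" for t
      using bound[of t] that by simp
    ultimately show ?thesis
      using dissipation(1) by (simp add: Y_def)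
  qed

  show ?thesis
    unfolding inv_\<kappa> \<kappa>_def[symmetric]
    using part1 part2 \<open>C > 0\<close> by blast
qed

end
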